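(* For the modified Leslie--Gower model with Beverton--Holt-type response on its double-zero parameter set (described in the context), let $$\Delta:=cr+(r+1)x_0-1,\qquad \Theta:=cr+2(r+1)x_0-1,$$ and assume $\Delta\neq0$. Then the distinguished restriction $$\mathcal R_Z(u)=\frac{r(r+1)^2x_0\,u^2(x_0+u)}{\Delta-(r+1)u}$$ has recurrence degree $$d_Z=\begin{cases}1,&\Theta\neq0,\\ 0,&\Theta=0.\end{cases}$$ Moreover, if $\mathcal R_Z(u)=\sum_{k\ge2}g_ku^k$, then $$g_2=\frac{r(r+1)^2x_0^2}{\Delta},$$ and, for every $k\ge3$, $$g_k=\frac{r(r+1)^{k-1}x_0\,\Theta}{\Delta^{k-1}}.$$ Hence all Taylor coefficients of the distinguished restriction of degree at least three share the factor $\Theta$.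
   Context: The model is $$\dot x=x(1-x)-\frac{\alpha x}{x+\beta}-rxy,\qquad \dot y=\frac{\delta y}{1+\eta y}\Bigl(1-\frac{y}{x+c}\Bigr),$$ with a positive equilibrium $E=(x_0,x_0+c)$. The double-zero parameter set is $$\beta=\frac{1-cr-2(r+1)x_0}{r+1},\quad \delta=rx_0\bigl(1+\eta(x_0+c)\bigr),\quad \alpha=\frac{(cr+(r+1)x_0-1)^2}{r+1},$$ so that $\Theta=-(r+1)\beta$. On this set the linearization is $J(E)=rx_0\begin{pmatrix}1&-1\\1&-1\end{pmatrix}$, assumed to be a nonzero nilpotent matrix (that is, $rx_0\neq0$), with Jordan chain $q_0=(1,1)^\top$, $q_1=(1/(rx_0),0)^\top$ and Jordan coordinates $(u,v)$ given by $x=x_0+u+\frac{v}{rx_0}$, $y=x_0+c+u$. The distinguished restriction $\mathcal R_Z(u)$ is the second component $\dot v$ of the system in these coordinates evaluated at $v=0$; it equals the rational function displayed in the claim. Recurrence degree: writing a rational restriction that is not identically zero as $\mathcal R(u)=u^2P(u)/Q(u)$ with polynomials $P,Q$, $\gcd(P,Q)=1$, $Q(0)\neq0$, the recurrence degree is $\deg Q$ (so it is $0$ if $\mathcal R/u^2$ is a polynomial); for the identically zero restriction it is set to $0$. *)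

theory Defs
  imports "HOL-Analysis.Analysis"
begin

text \<open>
  Phase points are pairs (x, y). Division by zero is 0 in HOL, so statements about the field
  are meaningful only where x + \<beta>, 1 + \<eta> y and x + c are nonzero.
\<close>
definition LG_field ::
  "real \<Rightarrow> real \<Rightarrow> real \<Rightarrow> real \<Rightarrow> real \<Rightarrow> real \<Rightarrow> real ^ 2 \<Rightarrow> real ^ 2" where
  "LG_field \<alpha> \<beta> r c \<delta> \<eta> z =
     (let x = z $ 1; y = z $ 2 in
      vector [x * (1 - x) - \<alpha> * x / (x + \<beta>) - r * x * y,
              \<delta> * y / (1 + \<eta> * y) * (1 - y / (x + c))])"

definition LG_equilibrium :: "real \<Rightarrow> real \<Rightarrow> real ^ 2" where
  "LG_equilibrium c x0 = vector [x0, x0 + c]"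

definition jordan_q0 :: "real ^ 2" where
  "jordan_q0 = vector [1, 1]"

definition jordan_q1 :: "real \<Rightarrow> real \<Rightarrow> real ^ 2" where
  "jordan_q1 r x0 = vector [1 / (r * x0), 0]"

text \<open>The transition matrix has the Jordan chain as its columns.\<close>
definition jordan_matrix :: "real \<Rightarrow> real \<Rightarrow> real ^ 2 ^ 2" where
  "jordan_matrix r x0 = transpose (vector [jordan_q0, jordan_q1 r x0])"

text \<open>Coordinates w = (u, v): x = x0 + u + v / (r x0), y = x0 + c + u.\<close>
definition jordan_chart :: "real \<Rightarrow> real \<Rightarrow> real \<Rightarrow> real ^ 2 \<Rightarrow> real ^ 2" where
  "jordan_chart r c x0 w = LG_equilibrium c x0 + jordan_matrix r x0 *v w"

definition LG_jordan_field ::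
  "real \<Rightarrow> real \<Rightarrow> real \<Rightarrow> real \<Rightarrow> real \<Rightarrow> real \<Rightarrow> real \<Rightarrow> real ^ 2 \<Rightarrow> real ^ 2" where
  "LG_jordan_field \<alpha> \<beta> r c \<delta> \<eta> x0 w =
     matrix_inv (jordan_matrix r x0) *v LG_field \<alpha> \<beta> r c \<delta> \<eta> (jordan_chart r c x0 w)"

definition distinguished_restriction ::
  "real \<Rightarrow> real \<Rightarrow> real \<Rightarrow> real \<Rightarrow> real \<Rightarrow> real \<Rightarrow> real \<Rightarrow> real \<Rightarrow> real" where
  "distinguished_restriction \<alpha> \<beta> r c \<delta> \<eta> x0 u =
     LG_jordan_field \<alpha> \<beta> r c \<delta> \<eta> x0 (vector [u, 0]) $ 2"

text \<open>
  A rational function is represented by a total real function that agrees with it at all but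
  finitely many points; two rational functions are equal iff they agree in this sense, so the
  values taken by HOL's totalised division at the poles are irrelevant.
  The predicate holds for no d if R is not rational or not divisible by u^2 at 0.
\<close>
definition has_recurrence_degree :: "(real \<Rightarrow> real) \<Rightarrow> nat \<Rightarrow> bool" where
  "has_recurrence_degree R d \<longleftrightarrow>
     (if \<forall>\<^sub>F u in cofinite. R u = 0 then d = 0
      else \<exists>P Q :: real poly. coprime P Q \<and> poly Q 0 \<noteq> 0 \<and>
             (\<forall>\<^sub>F u in cofinite. R u = u ^ 2 * poly P u / poly Q u) \<and>
             d = degree Q)"

end

theory Submission
  imports
    Defs
    "HOL-Computational_Algebra.Polynomial_Factorial"
    "HOL-Computational_Algebra.Field_as_Ring"
begin

text \<open>
  Along \<open>v = 0\<close> the chart is the line \<open>x = x0 + u\<close>, \<open>y = x0 + c + u = x + c\<close>, which is a nullcline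
  of the predator equation. A vector \<open>(a, b)\<close> has second Jordan coordinate \<open>r x0 (a - b)\<close>, so the
  distinguished restriction is just \<open>r x0\<close> times the prey component of the field. With
  \<open>s = (r + 1) u\<close> the double-zero conditions turn the prey growth rate
  \<open>1 - x - r y - \<alpha> / (x + \<beta>)\<close> into
  \<open>- (\<Delta> + s) + \<Delta>\<^sup>2 / (\<Delta> - s) = s\<^sup>2 / (\<Delta> - s)\<close>; this is the claimed formula.

  Divided by \<open>u\<^sup>2\<close> it is a constant multiple of \<open>(x0 + u) / (\<Delta> - (r + 1) u)\<close>. Numerator and
  denominator have a common root exactly when \<open>(r + 1) x0 + \<Delta> = 0\<close>, and this sum is \<open>\<Theta>\<close>: hence the
  drop of the recurrence degree at \<open>\<Theta> = 0\<close> (\<open>recurrence_degree_linear_fractional\<close>). The same quantity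
  is the factor in the Taylor coefficients, since
  \<open>(p + u) / (q - a u)\<close> has constant term \<open>p / q\<close> and then the geometric sequence with ratio \<open>a / q\<close>
  starting at \<open>(a p + q) / q\<^sup>2\<close> (\<open>linear_fractional_fps_expansion\<close>).

  Both answers are well defined: a reduced fraction determines its denominator up to a unit
  (\<open>has_recurrence_degree_iff\<close>), and a function has at most one power series expansion at 0
  (\<open>has_fps_expansion_unique\<close>).
\<close>

section \<open>Uniqueness of power series expansions\<close>

text \<open>
  If a nonzero series expanded the zero function, then removing the leading power would give a
  function continuous at 0 that vanishes off 0 but takes the leading coefficient as its value at 0.
  Unlike the argument through higher complex derivatives, this works over the reals too.
\<close>
lemma has_fps_expansion_zero_imp_zero:
  fixes H :: "'a :: {banach, real_normed_field} fps"
  assumes "(\<lambda>_. 0) has_fps_expansion H"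
  shows "H = 0"
proof (rule ccontr)
  assume "H \<noteq> 0"
  define c where "c = fps_nth H (subdegree H)"
  define g :: "'a \<Rightarrow> 'a" where "g = (\<lambda>x. if x = 0 then c else 0 / x ^ subdegree H)"
  have "g has_fps_expansion fps_shift (subdegree H) H"
    unfolding g_def by (rule has_fps_expansion_shift) (use assms in \<open>auto simp: c_def\<close>)
  then have "continuous (at 0) g"
    by (rule has_fps_expansion_imp_continuous)
  then have "(g \<longlongrightarrow> c) (at 0)"
    by (simp add: continuous_at g_def isCont_def)
  moreover have "(g \<longlongrightarrow> 0) (at 0)"
    by (rule tendsto_eventually) (auto simp: g_def eventually_at_filter)
  ultimately have "c = 0"
    using LIM_unique by blast
  with \<open>H \<noteq> 0\<close> show False
    by (simp add: c_def)
qed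

lemma has_fps_expansion_unique:
  fixes F G :: "'a :: {banach, real_normed_field} fps"
  assumes "f has_fps_expansion F" "f has_fps_expansion G"
  shows "F = G"
  using has_fps_expansion_zero_imp_zero[of "F - G"] has_fps_expansion_diff[OF assms] by simp

section \<open>The Taylor series of the linear fractional model\<close>

text \<open>
  The coefficients are read off from the recurrence \<open>q g\<^sub>k = a g\<^sub>k\<^sub>-\<^sub>1 + [k = 2] K p + [k = 3] K\<close>
  that clearing the denominator produces.
\<close>
lemma linear_fractional_fps_expansion:
  fixes K p q a :: "'a :: {banach, real_normed_field}"
  assumes "q \<noteq> 0"
  shows "(\<lambda>u. K * u ^ 2 * (p + u) / (q - a * u)) has_fps_expansion
    Abs_fps (\<lambda>k. if k < 2 then 0 else if k = 2 then K * p / q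
      else K * (a * p + q) * a ^ (k - 3) / q ^ (k - 1))" (is "_ has_fps_expansion ?G")
proof -
  let ?N = "fps_const K * fps_X ^ 2 * (fps_const p + fps_X)"
  let ?D = "fps_const q - fps_const a * fps_X"
  have D: "fps_nth ?D 0 \<noteq> 0"
    using assms by simp
  then have "?D \<noteq> 0"
    by (metis fps_zero_nth)
  have "fps_nth (?G * ?D) k = fps_nth ?N k" for k
  proof -
    have G: "fps_nth (?G * ?D) k = q * fps_nth ?G k - a * (if k = 0 then 0 else fps_nth ?G (k - 1))"
      by (simp add: algebra_simps)
    have N: "fps_nth ?N k = (if k = 2 then K * p else if k = 3 then K else 0)"
      by (auto simp: mult.assoc fps_X_power_mult_nth)
    consider "k < 2" | "k = 2" | "k = 3" | "k \<ge> 4"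
      by linarith
    then show ?thesis
    proof cases
      case 4
      then have "k - 1 = Suc (k - 2)" "k - 2 = Suc (k - 3)" "k - 3 = Suc (k - 4)"
        by auto
      with 4 show ?thesis
        unfolding G N using assms by (simp add: numeral_eq_Suc)
    qed (use assms in \<open>auto simp: G N field_simps power2_eq_square\<close>)
  qed
  then have "?N = ?G * ?D"
    by (simp add: fps_eq_iff)
  then have "?N / ?D = ?G"
    using \<open>?D \<noteq> 0\<close> by simp
  moreover have "(\<lambda>u. K * u ^ 2 * (p + u) / (q - a * u)) has_fps_expansion ?N / ?D"
    by (intro fps_expansion_intros D)
  ultimately show ?thesis
    by simp
qed

section \<open>Computing recurrence degrees\<close>

lemma eventually_cofinite_poly_nonzero:
  fixes p :: "'a :: idom poly"
  assumes "p \<noteq> 0"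
  shows "\<forall>\<^sub>F u in cofinite. poly p u \<noteq> 0"
  using poly_roots_finite[OF assms] by (simp add: eventually_cofinite)

lemma poly_eq_if_eventually_cofinite_eq:
  fixes p q :: "'a :: {idom, ring_char_0} poly"
  assumes "\<forall>\<^sub>F u in cofinite. poly p u = poly q u"
  shows "p = q"
proof (rule ccontr)
  assume "p \<noteq> q"
  then have "\<forall>\<^sub>F u in cofinite. poly (p - q) u \<noteq> 0"
    by (intro eventually_cofinite_poly_nonzero) simp
  with assms have "\<forall>\<^sub>F u in (cofinite :: 'a filter). False"
    by eventually_elim simp
  then show False
    by (simp add: eventually_cofinite infinite_UNIV_char_0)
qed

text \<open>
  Cross-multiplying two reduced representations gives \<open>P Q' = P' Q\<close>, so by coprimality the two
  denominators divide each other.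
\<close>
lemma has_recurrence_degree_iff:
  assumes cop: "coprime P Q" and Q0: "poly Q 0 \<noteq> 0" and "P \<noteq> 0"
    and R: "\<forall>\<^sub>F u in cofinite. R u = u ^ 2 * poly P u / poly Q u"
  shows "has_recurrence_degree R d \<longleftrightarrow> d = degree Q"
proof -
  have Q: "Q \<noteq> 0"
    using Q0 by auto
  have X: "\<forall>\<^sub>F u :: real in cofinite. u \<noteq> 0"
    by (simp add: eventually_cofinite)
  have not_zero: "\<not> (\<forall>\<^sub>F u in cofinite. R u = 0)"
  proof
    assume "\<forall>\<^sub>F u in cofinite. R u = 0"
    with R X eventually_cofinite_poly_nonzero[OF Q] have "\<forall>\<^sub>F u in cofinite. poly P u = poly 0 u"
      by eventually_elim auto
    then show False
      using poly_eq_if_eventually_cofinite_eq \<open>P \<noteq> 0\<close> by blast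
  qed
  have "degree Q' = degree Q"
    if cop': "coprime P' Q'" and "poly Q' 0 \<noteq> 0"
      and R': "\<forall>\<^sub>F u in cofinite. R u = u ^ 2 * poly P' u / poly Q' u" for P' Q' :: "real poly"
  proof -
    have Q': "Q' \<noteq> 0"
      using that by auto
    have "\<forall>\<^sub>F u in cofinite. poly (P * Q') u = poly (P' * Q) u"
      using R R' X eventually_cofinite_poly_nonzero[OF Q] eventually_cofinite_poly_nonzero[OF Q']
      by eventually_elim (auto simp: field_simps)
    then have eq: "P * Q' = P' * Q"
      by (rule poly_eq_if_eventually_cofinite_eq)
    have "Q dvd P * Q'"
      unfolding eq by simp
    then have "Q dvd Q'"
      using cop by (metis coprime_commute coprime_dvd_mult_right_iff)
    moreover have "Q' dvd P' * Q"
      unfolding eq[symmetric] by simp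
    then have "Q' dvd Q"
      using cop' by (metis coprime_commute coprime_dvd_mult_right_iff)
    ultimately show ?thesis
      using Q Q' by (intro order_antisym dvd_imp_degree_le)
  qed
  then have "(\<exists>P Q :: real poly. coprime P Q \<and> poly Q 0 \<noteq> 0 \<and>
      (\<forall>\<^sub>F u in cofinite. R u = u ^ 2 * poly P u / poly Q u) \<and> d = degree Q) \<longleftrightarrow> d = degree Q"
    using cop Q0 R by blast
  then show ?thesis
    unfolding has_recurrence_degree_def using not_zero by (simp only: if_False)
qed

text \<open>
  The resultant of \<open>p + u\<close> and \<open>q - a u\<close> is, up to sign, \<open>a p + q\<close>. If it vanishes, then
  \<open>q - a u = - a (p + u)\<close> and the quotient is constant; otherwise the fraction is reduced.
\<close>
lemma recurrence_degree_linear_fractional: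
  fixes K p q a :: real
  assumes "K \<noteq> 0" "q \<noteq> 0" "a \<noteq> 0"
    and R: "\<forall>\<^sub>F u in cofinite. R u = K * u ^ 2 * (p + u) / (q - a * u)"
  shows "has_recurrence_degree R d \<longleftrightarrow> d = (if a * p + q \<noteq> 0 then 1 else 0)"
proof (cases "a * p + q = 0")
  case True
  have "\<forall>\<^sub>F u in cofinite. poly [:q, - a:] u \<noteq> 0"
    using assms by (intro eventually_cofinite_poly_nonzero) simp
  with R have "\<forall>\<^sub>F u in cofinite. R u = u ^ 2 * poly [:- K / a:] u / poly 1 u"
  proof eventually_elim
    case (elim u)
    have "q - a * u = - a * (p + u)"
      using True by (simp add: algebra_simps)
    moreover from this have "p + u \<noteq> 0"
      using elim by auto
    ultimately show ?case
      using elim(1) \<open>a \<noteq> 0\<close> by simp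
  qed
  then show ?thesis
    using has_recurrence_degree_iff[of "[:- K / a:]" 1 R d] assms True by simp
next
  case False
  have "coprime [:K * p, K:] [:q, - a:]"
  proof (rule coprimeI)
    fix c
    assume "c dvd [:K * p, K:]" "c dvd [:q, - a:]"
    then have "c dvd smult (a / K) [:K * p, K:] + [:q, - a:]"
      by (intro dvd_add dvd_smult)
    also have "smult (a / K) [:K * p, K:] + [:q, - a:] = [:a * p + q:]"
      using assms by simp
    also have "\<dots> dvd 1"
      using False by (simp add: is_unit_const_poly_iff dvd_field_iff)
    finally show "c dvd 1" .
  qed
  moreover have "\<forall>\<^sub>F u in cofinite. R u = u ^ 2 * poly [:K * p, K:] u / poly [:q, - a:] u"
    using R by eventually_elim (simp add: algebra_simps)
  ultimately show ?thesis
    using has_recurrence_degree_iff[of "[:K * p, K:]" "[:q, - a:]" R d] assms False by simp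
qed

section \<open>The distinguished restriction\<close>

lemma matrix_inv_mult_vector_eq:
  fixes A :: "'a :: semiring_1 ^ 'n ^ 'm"
  assumes "invertible A" "A *v w = z"
  shows "matrix_inv A *v z = w"
proof -
  have "matrix_inv A ** A = mat 1"
    using someI_ex[OF assms(1)[unfolded invertible_def]] by (simp add: matrix_inv_def)
  then show ?thesis
    by (simp flip: assms(2) add: matrix_vector_mul_assoc)
qed

lemma jordan_matrix_mult_vector:
  "jordan_matrix r x0 *v w = vector [w $ 1 + w $ 2 / (r * x0), w $ 1]"
  by (simp add: jordan_matrix_def jordan_q0_def jordan_q1_def vec_eq_iff forall_2
      matrix_vector_mult_def sum_2 transpose_def)

lemma invertible_jordan_matrix:
  assumes "r * x0 \<noteq> 0"
  shows "invertible (jordan_matrix r x0)"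
proof -
  have "det (jordan_matrix r x0) \<noteq> 0"
    using assms by (simp add: det_2 jordan_matrix_def jordan_q0_def jordan_q1_def transpose_def)
  then show ?thesis
    by (simp add: invertible_det_nz)
qed

lemma jordan_matrix_inv_mult_vector:
  assumes "r * x0 \<noteq> 0"
  shows "matrix_inv (jordan_matrix r x0) *v z = vector [z $ 2, r * x0 * (z $ 1 - z $ 2)]"
  using assms
  by (intro matrix_inv_mult_vector_eq invertible_jordan_matrix)
     (auto simp: jordan_matrix_mult_vector vec_eq_iff forall_2)

text \<open>
  Where \<open>x + c \<noteq> 0\<close>, the predator equation is stationary on \<open>y = x + c\<close>, so only the prey equation
  contributes.
\<close>
lemma distinguished_restriction_eq_prey:
  assumes "r * x0 \<noteq> 0" "x0 + u + c \<noteq> 0"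
  shows "distinguished_restriction \<alpha> \<beta> r c \<delta> \<eta> x0 u =
    r * x0 * (x0 + u) * (1 - (x0 + u) - r * (x0 + u + c) - \<alpha> / (x0 + u + \<beta>))"
proof -
  let ?z = "jordan_chart r c x0 (vector [u, 0])"
  have chart: "?z $ 1 = x0 + u" "?z $ 2 = x0 + u + c"
    by (simp_all add: jordan_chart_def LG_equilibrium_def jordan_matrix_mult_vector)
  have "LG_field \<alpha> \<beta> r c \<delta> \<eta> ?z $ 2 = 0"
    using assms(2) by (simp add: LG_field_def Let_def chart)
  moreover have "LG_field \<alpha> \<beta> r c \<delta> \<eta> ?z $ 1 =
      (x0 + u) * (1 - (x0 + u) - r * (x0 + u + c) - \<alpha> / (x0 + u + \<beta>))"
    unfolding LG_field_def Let_def vector_2 chart by (simp add: right_diff_distrib mult_ac)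
  ultimately show ?thesis
    using assms(1)
    by (simp add: distinguished_restriction_def LG_jordan_field_def jordan_matrix_inv_mult_vector)
qed

lemma distinguished_restriction_double_zero:
  fixes \<alpha> \<beta> r c \<delta> \<eta> x0 u :: real
  defines "\<Delta> \<equiv> c * r + (r + 1) * x0 - 1"
  assumes "r * x0 \<noteq> 0" "r + 1 \<noteq> 0" "x0 + u + c \<noteq> 0" "x0 + u + \<beta> \<noteq> 0"
    and beta: "\<beta> = (1 - c * r - 2 * (r + 1) * x0) / (r + 1)"
    and alpha: "\<alpha> = \<Delta> ^ 2 / (r + 1)"
  shows "distinguished_restriction \<alpha> \<beta> r c \<delta> \<eta> x0 u =
    r * (r + 1) ^ 2 * x0 * u ^ 2 * (x0 + u) / (\<Delta> - (r + 1) * u)"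
proof -
  define s where "s = (r + 1) * u"
  have den: "x0 + u + \<beta> = (s - \<Delta>) / (r + 1)"
    using assms(3) by (simp add: beta \<Delta>_def s_def field_simps)
  have nz: "\<Delta> - s \<noteq> 0"
    using assms(5) den by auto
  have response: "\<alpha> / (x0 + u + \<beta>) = - (\<Delta> ^ 2 / (\<Delta> - s))"
    unfolding den alpha using assms(3) nz by (simp add: divide_simps) (simp add: algebra_simps)
  have growth: "1 - (x0 + u) - r * (x0 + u + c) = - (\<Delta> + s)"
    by (simp add: \<Delta>_def s_def algebra_simps)
  have "- (\<Delta> + s) - - (\<Delta> ^ 2 / (\<Delta> - s)) = s ^ 2 / (\<Delta> - s)"
    using nz by (simp add: field_simps power2_eq_square)
  then show ?thesis
    unfolding distinguished_restriction_eq_prey[OF assms(2,4)] response growth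
    by (simp add: s_def power_mult_distrib)
qed

theorem proposition6p5:
  fixes \<alpha> \<beta> r c \<delta> \<eta> x0 \<Delta> \<Theta> :: real and R :: "real \<Rightarrow> real"
  assumes positive_equilibrium: "x0 > 0" "x0 + c > 0"
    and response_defined: "1 + \<eta> * (x0 + c) \<noteq> 0"
    and nonzero_nilpotent: "r * x0 \<noteq> 0"
    and r1: "r + 1 \<noteq> 0"
    and beta: "\<beta> = (1 - c * r - 2 * (r + 1) * x0) / (r + 1)"
    and delta: "\<delta> = r * x0 * (1 + \<eta> * (x0 + c))"
    and alpha: "\<alpha> = (c * r + (r + 1) * x0 - 1) ^ 2 / (r + 1)"
    and Delta: "\<Delta> = c * r + (r + 1) * x0 - 1"
    and Theta: "\<Theta> = c * r + 2 * (r + 1) * x0 - 1"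
    and Delta_nonzero: "\<Delta> \<noteq> 0"
    and R: "R = distinguished_restriction \<alpha> \<beta> r c \<delta> \<eta> x0"
  shows "(\<forall>u. x0 + u + \<beta> \<noteq> 0 \<longrightarrow> 1 + \<eta> * (x0 + c + u) \<noteq> 0 \<longrightarrow> x0 + u + c \<noteq> 0 \<longrightarrow>
            R u = r * (r + 1) ^ 2 * x0 * u ^ 2 * (x0 + u) / (\<Delta> - (r + 1) * u))
       \<and> (\<forall>d. has_recurrence_degree R d \<longleftrightarrow> d = (if \<Theta> \<noteq> 0 then 1 else 0))
       \<and> (\<exists>G. R has_fps_expansion G)
       \<and> (\<forall>G. R has_fps_expansion G \<longrightarrow>
            fps_nth G 0 = 0 \<and> fps_nth G 1 = 0
            \<and> fps_nth G 2 = r * (r + 1) ^ 2 * x0 ^ 2 / \<Delta>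
            \<and> (\<forall>k\<ge>3. fps_nth G k = r * (r + 1) ^ (k - 1) * x0 * \<Theta> / \<Delta> ^ (k - 1))
            \<and> (\<forall>k\<ge>3. \<Theta> dvd fps_nth G k))"
proof -
  let ?f = "\<lambda>u. r * (r + 1) ^ 2 * x0 * u ^ 2 * (x0 + u) / (\<Delta> - (r + 1) * u)"
  have formula: "R u = ?f u" if "x0 + u + \<beta> \<noteq> 0" "x0 + u + c \<noteq> 0" for u
    unfolding R Delta
    by (rule distinguished_restriction_double_zero) (use assms that in auto)
  have Theta_eq: "(r + 1) * x0 + \<Delta> = \<Theta>"
    by (simp add: Delta Theta algebra_simps)

  have "\<forall>\<^sub>F u in cofinite. poly [:x0 + \<beta>, 1:] u \<noteq> 0" "\<forall>\<^sub>F u in cofinite. poly [:x0 + c, 1:] u \<noteq> 0"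
    by (intro eventually_cofinite_poly_nonzero; simp)+
  then have "\<forall>\<^sub>F u in cofinite. R u = ?f u"
    by eventually_elim (rule formula; simp add: algebra_simps)
  then have degree: "has_recurrence_degree R d \<longleftrightarrow> d = (if \<Theta> \<noteq> 0 then 1 else 0)" for d
    using recurrence_degree_linear_fractional[of "r * (r + 1) ^ 2 * x0" \<Delta> "r + 1" R x0 d]
      nonzero_nilpotent r1 Delta_nonzero Theta_eq by (simp add: mult_ac)

  \<comment> \<open>The condition \<open>\<Delta> \<noteq> 0\<close> says that the equilibrium is not at the pole of the response, which makes
    the closed formula valid on a whole neighbourhood of \<open>u = 0\<close>.\<close>
  have "x0 + \<beta> = - \<Delta> / (r + 1)"
    using r1 by (simp add: beta Delta field_simps)
  then have "x0 + \<beta> \<noteq> 0"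
    using r1 Delta_nonzero by simp
  have "\<forall>\<^sub>F u in nhds 0. x0 + u + b \<noteq> 0" if "x0 + b \<noteq> 0" for b
  proof (rule tendsto_imp_eventually_ne)
    show "((\<lambda>u. x0 + u + b) \<longlongrightarrow> x0 + 0 + b) (nhds 0)"
      by (intro tendsto_intros filterlim_ident)
  qed (use that in simp)
  from this[OF \<open>x0 + \<beta> \<noteq> 0\<close>] this[of c]
  have "\<forall>\<^sub>F u in nhds 0. x0 + u + \<beta> \<noteq> 0" "\<forall>\<^sub>F u in nhds 0. x0 + u + c \<noteq> 0"
    using positive_equilibrium by simp_all
  then have near_0: "\<forall>\<^sub>F u in nhds 0. ?f u = R u"
    by eventually_elim (simp add: formula)
  define G where "G = Abs_fps (\<lambda>k. if k < 2 then 0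
    else if k = 2 then r * (r + 1) ^ 2 * x0 * x0 / \<Delta>
    else r * (r + 1) ^ 2 * x0 * ((r + 1) * x0 + \<Delta>) * (r + 1) ^ (k - 3) / \<Delta> ^ (k - 1))"
  have "?f has_fps_expansion G"
    unfolding G_def by (rule linear_fractional_fps_expansion) (rule Delta_nonzero)
  then have expansion: "R has_fps_expansion G"
    using near_0 unfolding has_fps_expansion_def by (auto elim: eventually_elim2)
  have high: "fps_nth G k = r * (r + 1) ^ (k - 1) * x0 * \<Theta> / \<Delta> ^ (k - 1)" if "k \<ge> 3" for k
  proof -
    have "k - 1 = 2 + (k - 3)"
      using that by simp
    then have "(r + 1) ^ (k - 1) = (r + 1) ^ 2 * (r + 1) ^ (k - 3)"
      by (metis power_add)
    then show ?thesis
      using that by (simp add: G_def Theta_eq)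
  qed
  then have "\<Theta> dvd fps_nth G k" if "k \<ge> 3" for k
    using that by (simp add: dvd_field_iff)
  moreover have "fps_nth G 2 = r * (r + 1) ^ 2 * x0 ^ 2 / \<Delta>"
    by (simp add: G_def power2_eq_square)
  moreover have "fps_nth G 0 = 0" "fps_nth G 1 = 0"
    by (simp_all add: G_def)
  moreover have "G' = G" if "R has_fps_expansion G'" for G'
    using that expansion by (rule has_fps_expansion_unique)
  ultimately show ?thesis
    using formula degree expansion high by blast
qed

end
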